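(* $gr^3_2(B_{10})=17$.
   Context: $K_n$ is the complete graph of order $n$. The book $B_n:=K_2+nK_1$ (graph join) is the graph on $n+2$ vertices consisting of an edge $xy$ (the spine) together with $n$ further, pairwise non-adjacent vertices (the pages), each adjacent to both $x$ and $y$. A $t$-coloring of $K_p$ is a map $f:E(K_p)\to\{1,\dots,t\}$, not assumed surjective. A Gallai $t$-coloring is a $t$-coloring with no rainbow triangle, i.e. there are no three vertices $x,y,z$ such that $f(xy),f(xz),f(yz)$ are pairwise distinct. For $1\le s<t$ and a graph $G$, the weakened Gallai-Ramsey number $gr^t_s(G)$ is the least $p\in\mathbb{N}$ such that every Gallai $t$-coloring of $K_p$ contains a (not necessarily induced) subgraph isomorphic to $G$ whose edges use at most $s$ colors. *)

theory Defs
  imports Main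
begin

text \<open>A graph is a set of vertices together with a set of edges, an edge being the
  two-element set of its endpoints; \<open>simple_graph\<close> is the corresponding well-formedness
  condition.\<close>

record 'a sgraph =
  verts :: "'a set"
  edges :: "'a set set"

definition all_edges :: "'a set \<Rightarrow> 'a set set" where
  "all_edges V = {e. e \<subseteq> V \<and> card e = 2}"

definition simple_graph :: "'a sgraph \<Rightarrow> bool" where
  "simple_graph G \<longleftrightarrow> edges G \<subseteq> all_edges (verts G)"

definition subgraph :: "'a sgraph \<Rightarrow> 'a sgraph \<Rightarrow> bool" where
  "subgraph H G \<longleftrightarrow> simple_graph H \<and> verts H \<subseteq> verts G \<and> edges H \<subseteq> edges G"

definition isomorphic :: "'a sgraph \<Rightarrow> 'b sgraph \<Rightarrow> bool" where
  "isomorphic G H \<longleftrightarrow>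
     (\<exists>h. bij_betw h (verts G) (verts H) \<and>
          (\<forall>u\<in>verts G. \<forall>v\<in>verts G. {u, v} \<in> edges G \<longleftrightarrow> {h u, h v} \<in> edges H))"

definition complete_graph :: "nat \<Rightarrow> nat sgraph" where
  "complete_graph n = \<lparr>verts = {..<n}, edges = all_edges {..<n}\<rparr>"

text \<open>The graph \<open>n K\<^sub>1\<close>.\<close>

definition edgeless_graph :: "nat \<Rightarrow> nat sgraph" where
  "edgeless_graph n = \<lparr>verts = {..<n}, edges = {}\<rparr>"

definition graph_join :: "'a sgraph \<Rightarrow> 'b sgraph \<Rightarrow> ('a + 'b) sgraph" where
  "graph_join G H =
     \<lparr>verts = verts G <+> verts H,
      edges = (image Inl) ` edges G \<union> (image Inr) ` edges H
                \<union> {{Inl u, Inr v} | u v. u \<in> verts G \<and> v \<in> verts H}\<rparr>"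

definition book :: "nat \<Rightarrow> (nat + nat) sgraph" where
  "book n = graph_join (complete_graph 2) (edgeless_graph n)"

text \<open>Colorings are total functions on vertex sets of which only the values on the edges of
  \<open>K\<^sub>p\<close> matter; they need not use every color in \<open>{1..t}\<close>.\<close>

definition coloring :: "nat \<Rightarrow> nat \<Rightarrow> (nat set \<Rightarrow> nat) \<Rightarrow> bool" where
  "coloring t p f \<longleftrightarrow> (\<forall>e\<in>edges (complete_graph p). f e \<in> {1..t})"

definition rainbow_triangle :: "nat \<Rightarrow> (nat set \<Rightarrow> nat) \<Rightarrow> nat \<Rightarrow> nat \<Rightarrow> nat \<Rightarrow> bool" where
  "rainbow_triangle p f x y z \<longleftrightarrow>
     {x, y, z} \<subseteq> verts (complete_graph p) \<and> x \<noteq> y \<and> x \<noteq> z \<and> y \<noteq> z \<and>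
     f {x, y} \<noteq> f {x, z} \<and> f {x, y} \<noteq> f {y, z} \<and> f {x, z} \<noteq> f {y, z}"

definition gallai_coloring :: "nat \<Rightarrow> nat \<Rightarrow> (nat set \<Rightarrow> nat) \<Rightarrow> bool" where
  "gallai_coloring t p f \<longleftrightarrow>
     coloring t p f \<and> (\<nexists>x y z. rainbow_triangle p f x y z)"

definition has_copy_with_colors ::
    "nat \<Rightarrow> nat \<Rightarrow> (nat set \<Rightarrow> nat) \<Rightarrow> 'a sgraph \<Rightarrow> bool" where
  "has_copy_with_colors s p f G \<longleftrightarrow>
     (\<exists>H. subgraph H (complete_graph p) \<and> isomorphic G H \<and> card (f ` edges H) \<le> s)"

text \<open>The weakened Gallai-Ramsey number \<open>gr\<^sup>t\<^sub>s(G)\<close>, intended for \<open>1 \<le> s < t\<close>; the argument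
  order is \<open>t s G\<close>. Its value is unspecified if no \<open>p\<close> has the
  property, so it can be shown to equal a given numeral only by exhibiting such a \<open>p\<close>.\<close>

definition gallai_ramsey :: "nat \<Rightarrow> nat \<Rightarrow> 'a sgraph \<Rightarrow> nat" where
  "gallai_ramsey t s G =
     (LEAST p. \<forall>f. gallai_coloring t p f \<longrightarrow> has_copy_with_colors s p f G)"

end

(* For a color k and an edge xy not colored k, the book with spine xy avoiding color k has as
   pages exactly the vertices outside N_k(x) and N_k(y).  So a Gallai 3-coloring of K_17 without
   a two-colored B_10 satisfies |N_k(x) \<union> N_k(y)| \<ge> 6 whenever f(xy) \<noteq> k.  In every Gallai
   3-coloring some color is disconnected, and the edges between two of its components all have
   the same color.  With two or three components this yields a bipartition of the vertices with
   a single color across; counting inside the smaller side leaves either 8 vertices colored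
   with two colors and no monochromatic triangle, or a single vertex.  In the latter case the
   same dichotomy is applied to the other 16 vertices.  With four or more components, some
   component is a clique on 4 vertices, and the remaining components cannot provide enough
   neighbors in both other colors.

   The coloring of K_16 consists of the pentagon coloring of K_5 blown up by triangles of the
   third color, with one more vertex joined to everything in that color. *)

theory Submission
  imports Defs
begin

section \<open>Components of a Gallai 3-coloring\<close>

text \<open>The vertex set is arbitrary so that the locale can be entered again after deleting a
  vertex. Symmetry of \<open>c\<close>, required everywhere, is automatic for
  \<open>c x y = f {x, y}\<close>.\<close>

locale gallai =
  fixes V :: "'a set" and c :: "'a \<Rightarrow> 'a \<Rightarrow> nat"
  assumes fin: "finite V"
    and sym: "c x y = c y x"
    and col: "x \<in> V \<Longrightarrow> y \<in> V \<Longrightarrow> x \<noteq> y \<Longrightarrow> c x y \<in> {1,2,3}"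
    and no_rainbow: "x \<in> V \<Longrightarrow> y \<in> V \<Longrightarrow> z \<in> V \<Longrightarrow> x \<noteq> y \<Longrightarrow> x \<noteq> z \<Longrightarrow> y \<noteq> z \<Longrightarrow>
      c x y = c x z \<or> c x y = c y z \<or> c x z = c y z"
begin

definition nbr :: "nat \<Rightarrow> 'a \<Rightarrow> 'a set" where
  "nbr k x = {z \<in> V. z \<noteq> x \<and> c x z = k}"

definition adj :: "nat \<Rightarrow> ('a \<times> 'a) set" where
  "adj k = {(x, y). x \<in> V \<and> y \<in> V \<and> x \<noteq> y \<and> c x y = k}"

definition comp :: "nat \<Rightarrow> 'a \<Rightarrow> 'a set" where
  "comp k x = (adj k)\<^sup>* `` {x}"

lemma finite_nbr [simp]: "finite (nbr k x)"
  using fin by (simp add: nbr_def)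

lemma comp_self [simp]: "x \<in> comp k x"
  by (simp add: comp_def)

lemma comp_subset: "x \<in> V \<Longrightarrow> comp k x \<subseteq> V"
proof
  fix y assume "x \<in> V" "y \<in> comp k x"
  then have "(x, y) \<in> (adj k)\<^sup>*" by (simp add: comp_def)
  then show "y \<in> V" using \<open>x \<in> V\<close> by (induction) (auto simp: adj_def)
qed

lemma finite_comp: "x \<in> V \<Longrightarrow> finite (comp k x)"
  using comp_subset fin finite_subset by blast

lemma comp_eq: "y \<in> comp k x \<Longrightarrow> comp k y = comp k x"
proof -
  assume "y \<in> comp k x"
  then have xy: "(x, y) \<in> (adj k)\<^sup>*" by (simp add: comp_def)
  have "sym (adj k)" using sym by (auto simp: adj_def intro!: symI)
  then have "(y, x) \<in> (adj k)\<^sup>*" using xy by (meson sym_rtrancl symD)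
  with xy show ?thesis unfolding comp_def by (auto intro: rtrancl_trans)
qed

lemma comp_disjoint: "comp k x \<noteq> comp k y \<Longrightarrow> comp k x \<inter> comp k y = {}"
  using comp_eq by blast

lemma comp_edge: "x \<in> V \<Longrightarrow> y \<in> V \<Longrightarrow> x \<noteq> y \<Longrightarrow> c x y = k \<Longrightarrow> comp k y = comp k x"
  by (rule comp_eq) (auto simp: comp_def adj_def)

text \<open>Follow a path of color \<open>k\<close> from \<open>x\<close> to \<open>y\<close>. At
  each step from \<open>u\<close> to \<open>v\<close> the edges \<open>z u\<close> and
  \<open>z v\<close> leave the component, hence are not colored \<open>k\<close>, while
  \<open>u v\<close> is; since the triangle is not rainbow, they agree.\<close>

lemma homogeneous1:
  assumes "z \<in> V" "x \<in> V" "y \<in> comp k x" "comp k z \<noteq> comp k x"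
  shows "c z y = c z x"
proof -
  have "(x, y) \<in> (adj k)\<^sup>*" using assms by (simp add: comp_def)
  then show ?thesis
  proof (induction)
    case base show ?case ..
  next
    case (step u v)
    have uv: "u \<in> V" "v \<in> V" "u \<noteq> v" "c u v = k" using step.hyps(2) by (auto simp: adj_def)
    have u: "comp k u = comp k x" by (rule comp_eq) (simp add: comp_def step.hyps(1))
    have v: "comp k v = comp k x" using comp_edge uv u by metis
    have "z \<noteq> u" "z \<noteq> v" using u v assms by auto
    moreover have "c z u \<noteq> k" "c z v \<noteq> k"
      using comp_edge[of z u k] comp_edge[of z v k] u v uv assms(1,4) calculation by auto
    ultimately show ?case using no_rainbow[of z u v] uv assms(1) step.IH by metis
  qed
qed

text \<open>Move one endpoint at a time. So components of color \<open>k\<close> can be contracted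
  to single vertices.\<close>

lemma homogeneous:
  assumes "x \<in> V" "y \<in> V" "x' \<in> comp k x" "y' \<in> comp k y" "comp k x \<noteq> comp k y"
  shows "c x' y' = c x y"
proof -
  have "x' \<in> V" using comp_subset assms by blast
  have "c x' y' = c x' y"
    using homogeneous1[of x' y y' k] comp_eq[OF assms(3)] assms \<open>x' \<in> V\<close> by simp
  also have "\<dots> = c y x'" by (rule sym)
  also have "\<dots> = c y x" using homogeneous1[of y x x' k] assms by simp
  also have "\<dots> = c x y" by (rule sym)
  finally show ?thesis .
qed

lemma nbr_subset_comp: "x \<in> V \<Longrightarrow> nbr k x \<subseteq> comp k x - {x}"
  unfolding nbr_def using comp_edge[of x _ k] comp_self by blast

lemma card_nbr_less_comp: "x \<in> V \<Longrightarrow> card (nbr k x) < card (comp k x)"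
  using nbr_subset_comp[of x k] comp_self[of x k] by (intro psubset_card_mono finite_comp) auto

lemma three_comps:
  assumes "x \<in> V" "4 \<le> card (comp k ` V)"
  obtains y z w where "y \<in> V" "z \<in> V" "w \<in> V"
    "comp k y \<noteq> comp k x" "comp k z \<noteq> comp k x" "comp k w \<noteq> comp k x"
    "comp k y \<noteq> comp k z" "comp k y \<noteq> comp k w" "comp k z \<noteq> comp k w"
proof -
  have "3 \<le> card (comp k ` V - {comp k x})" using assms fin by (simp add: card_Diff_singleton)
  then obtain T where T: "T \<subseteq> comp k ` V - {comp k x}" "card T = 3"
    by (meson obtain_subset_with_card_n)
  then obtain X Y Z where "T = {X, Y, Z}" "X \<noteq> Y" "X \<noteq> Z" "Y \<noteq> Z"
    by (auto simp: card_3_iff)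
  with T that show ?thesis by auto
qed

lemma four_comps_card:
  assumes V: "x \<in> V" "y \<in> V" "z \<in> V" "w \<in> V"
    and "comp k y \<noteq> comp k x" "comp k z \<noteq> comp k x" "comp k w \<noteq> comp k x"
    "comp k y \<noteq> comp k z" "comp k y \<noteq> comp k w" "comp k z \<noteq> comp k w"
  shows "card (comp k x) + card (comp k y) + card (comp k z) + card (comp k w) \<le> card V"
proof -
  note d = assms(5-)[THEN comp_disjoint]
  note f = V[THEN finite_comp, of k]
  have "card (comp k x \<union> (comp k y \<union> (comp k z \<union> comp k w)))
      = card (comp k x) + (card (comp k y) + (card (comp k z) + card (comp k w)))"
    using d f by (subst card_Un_disjoint, simp, simp, blast)+ simp
  moreover have "card (comp k x \<union> (comp k y \<union> (comp k z \<union> comp k w))) \<le> card V"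
    using V[THEN comp_subset, of k] fin by (intro card_mono) auto
  ultimately show ?thesis by simp
qed

lemma gallai_subset: "U \<subseteq> V \<Longrightarrow> gallai U c"
  unfolding gallai_def using fin sym col no_rainbow by (simp add: subset_iff finite_subset)

end

section \<open>Existence of a disconnected color\<close>

lemma other_colors:
  assumes "i \<in> {1,2,3::nat}"
  obtains j k where "j \<in> {1,2,3}" "k \<in> {1,2,3}" "j \<noteq> i" "k \<noteq> i" "j \<noteq> k" "{1,2,3} = {i,j,k}"
proof -
  consider "i = 1" | "i = 2" | "i = 3" using assms by auto
  then show thesis
  proof cases
    case 1 then show thesis by (intro that[of 2 3]) auto
  next
    case 2 then show thesis by (intro that[of 1 3]) auto
  next
    case 3 then show thesis by (intro that[of 1 2]) auto
  qed
qed

text \<open>Gallai's theorem for three colors, by deleting a vertex \<open>v\<close>. The rest has a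
  disconnected color \<open>k\<close>. If all colors were connected on \<open>V\<close>, then
  \<open>v\<close> would send color \<open>k\<close> to every component of color \<open>k\<close> in
  the rest, and would also send both other colors; homogeneity forces these two to coincide.\<close>

lemma gallai_disconnected:
  assumes "gallai V c" "2 \<le> card V"
  shows "\<exists>k\<in>{1,2,3}. \<exists>A. A \<noteq> {} \<and> A \<subset> V \<and> (\<forall>x\<in>A. \<forall>y\<in>V-A. c x y \<noteq> k)"
  using assms
proof (induction "card V" arbitrary: V rule: less_induct)
  case less
  interpret gallai V c by fact
  show ?case
  proof (cases "card V = 2")
    case True
    then obtain x y where V: "V = {x, y}" "x \<noteq> y" by (auto simp: card_2_iff)
    define k :: nat where "k = (if c x y = 1 then 2 else 1)"
    then have "k \<in> {1,2,3}" "c x y \<noteq> k" by auto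
    moreover have "{x} \<noteq> {} \<and> {x} \<subset> V \<and> (\<forall>a\<in>{x}. \<forall>b\<in>V-{x}. c a b \<noteq> k)"
      using V \<open>c x y \<noteq> k\<close> by auto
    ultimately show ?thesis by blast
  next
    case False
    obtain v where v: "v \<in> V" using less.prems(2) by fastforce
    define W where "W = V - {v}"
    have cW: "card W = card V - 1" using v by (simp add: W_def)
    have "gallai W c" by (rule gallai_subset) (auto simp: W_def)
    interpret W: gallai W c by fact
    have "card W < card V" "2 \<le> card W" using cW False less.prems(2) by auto
    then obtain k A where k: "k \<in> {1,2,3}" and A: "A \<noteq> {}" "A \<subset> W" "\<forall>x\<in>A. \<forall>y\<in>W-A. c x y \<noteq> k"
      using less.hyps[OF _ \<open>gallai W c\<close>] by blast
    show ?thesis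
    proof (rule ccontr)
      assume neg: "\<not> ?thesis"
      have edge: "\<exists>x\<in>C. \<exists>y\<in>V-C. c x y = l" if "l \<in> {1,2,3}" "C \<noteq> {}" "C \<subset> V" for l C
        using neg that by blast
      \<comment> \<open>As \<open>k\<close> is connected on \<open>V\<close>, some edge of color
        \<open>k\<close> leaves each component of \<open>W\<close>, and it can only end at
        \<open>v\<close>.\<close>
      have vk: "\<exists>w\<in>W. W.comp k w = W.comp k u \<and> c v w = k" if u: "u \<in> W" for u
      proof -
        have sub: "W.comp k u \<subseteq> W" by (rule W.comp_subset[OF u])
        then have "W.comp k u \<subset> V" using v by (auto simp: W_def)
        then obtain x y where xy: "x \<in> W.comp k u" "y \<in> V - W.comp k u" "c x y = k"
          using edge[OF k, of "W.comp k u"] W.comp_self by blast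
        have "y = v"
        proof (rule ccontr)
          assume "y \<noteq> v"
          then have "y \<in> W" using xy by (auto simp: W_def)
          then have "W.comp k y = W.comp k x" using W.comp_edge[of x y k] xy sub by auto
          then show False using W.comp_eq[OF xy(1)] W.comp_self[of y k] xy(2) by auto
        qed
        then show ?thesis using xy W.comp_eq[OF xy(1)] sub sym by auto
      qed
      \<comment> \<open>No edge of color \<open>k\<close> joins \<open>A\<close> to
        \<open>W - A\<close>, so \<open>W\<close> has at least two components of color
        \<open>k\<close>.\<close>
      have other: "\<exists>w\<in>W. W.comp k w \<noteq> W.comp k u" if "u \<in> W" for u
      proof -
        obtain a b where ab: "a \<in> A" "b \<in> W - A" using A by blast
        have "y \<in> A" if "y \<in> W.comp k a" for y
        proof -
          have "(a, y) \<in> (W.adj k)\<^sup>*" using that by (simp add: W.comp_def)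
          then show ?thesis by induction (use ab A(3) in \<open>auto simp: W.adj_def\<close>)
        qed
        then have "W.comp k b \<noteq> W.comp k a" using ab W.comp_self[of b k] by blast
        then show ?thesis using ab A(2) by (cases "W.comp k a = W.comp k u") auto
      qed
      have seen: "\<exists>u\<in>W. c v u = l" if "l \<in> {1,2,3}" for l
      proof -
        have "{v} \<subset> V" using v cW less.prems(2) by (auto simp: W_def)
        then show ?thesis using edge[OF that, of "{v}"] by (auto simp: W_def)
      qed
      \<comment> \<open>In the triangle \<open>v u w\<close> only \<open>v w\<close> is colored
        \<open>k\<close>, so the other two edges agree.\<close>
      have spread: "c u w = c v u"
        if "u \<in> W" "w \<in> W" "c v u \<noteq> k" "c v w = k" "W.comp k w \<noteq> W.comp k u" for u w
      proof -
        have "u \<noteq> w" using that by auto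
        then have "c u w \<noteq> k" using W.comp_edge[of u w k] that by auto
        then show ?thesis using no_rainbow[of v u w] v that \<open>u \<noteq> w\<close> by (auto simp: W_def)
      qed
      obtain j l where jl: "j \<in> {1,2,3}" "l \<in> {1,2,3}" "j \<noteq> k" "l \<noteq> k" "j \<noteq> l"
        by (rule other_colors[OF k]) blast
      obtain u where u: "u \<in> W" "c v u = j" using seen jl by blast
      obtain u' where u': "u' \<in> W" "c v u' = l" using seen jl by blast
      show False
      proof (cases "W.comp k u = W.comp k u'")
        \<comment> \<open>A vertex \<open>w\<close> of another component is joined to
          \<open>u\<close> in color \<open>j\<close> and to \<open>u'\<close> in color
          \<open>l\<close>, against homogeneity.\<close>
        case True
        obtain w where w: "w \<in> W" "W.comp k w \<noteq> W.comp k u" "c v w = k"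
          using other[OF u(1)] vk by metis
        have "c u w = j" "c u' w = l" using spread u u' w jl True by auto
        moreover have "c u' w = c u w"
          using W.homogeneous[of u w u' k w] W.comp_self[of u' k] u u' w True by simp
        ultimately show False using jl by simp
      next
        \<comment> \<open>The edges \<open>u w'\<close> and \<open>u' w\<close> have colors
          \<open>j\<close> and \<open>l\<close>, but by homogeneity both have the color of
          \<open>u u'\<close>.\<close>
        case False
        obtain w where w: "w \<in> W" "W.comp k w = W.comp k u" "c v w = k" using vk u by metis
        obtain w' where w': "w' \<in> W" "W.comp k w' = W.comp k u'" "c v w' = k" using vk u' by metis
        have "c u w' = j" "c u' w = l" using spread u u' w w' jl False by auto
        moreover have "c u w' = c u u'"
          using W.homogeneous[of u u' u k w'] W.comp_self[of w' k] u u' w' False by simp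
        moreover have "c u' w = c u' u"
          using W.homogeneous[of u' u u' k w] W.comp_self[of w k] u u' w False by simp
        ultimately show False using jl sym[of u u'] by simp
      qed
    qed
  qed
qed


section \<open>Monochromatic bipartitions and colors with many components\<close>

context gallai
begin

text \<open>Contract the components of a disconnected color. Two of them already form a bipartition.
  With three, the triangle on representatives has two edges of equal color, and the component where
  these meet is joined to the rest in that color.\<close>

lemma join_or_many_comps:
  assumes "2 \<le> card V"
  shows "(\<exists>A l. A \<noteq> {} \<and> A \<subset> V \<and> (\<forall>x\<in>A. \<forall>y\<in>V-A. c x y = l)) \<or>
    (\<exists>i\<in>{1,2,3}. 4 \<le> card (comp i ` V))"
proof -
  obtain k A where k: "k \<in> {1,2,3}" and A: "A \<noteq> {}" "A \<subset> V" "\<forall>x\<in>A. \<forall>y\<in>V-A. c x y \<noteq> k"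
    using gallai_disconnected[OF gallai_axioms assms] by blast
  \<comment> \<open>Taking \<open>z = y\<close> covers the case of two components.\<close>
  have join: ?thesis
    if "x \<in> V" "y \<in> V" "z \<in> V" "comp k x \<noteq> comp k y" "comp k x \<noteq> comp k z" "c x y = c x z"
      "\<forall>w\<in>V. comp k w \<in> {comp k x, comp k y, comp k z}" for x y z
  proof -
    note xyz = that
    have "comp k x \<subset> V" using that(1,2,4) comp_subset[of x k] comp_self[of y k] comp_eq[of y k x] by blast
    moreover have "c u v = c x y" if uv: "u \<in> comp k x" "v \<in> V - comp k x" for u v
    proof -
      have "comp k v \<noteq> comp k x" using uv comp_self[of v k] by auto
      then have "v \<in> comp k y \<or> v \<in> comp k z" using xyz(7) uv comp_self[of v k] by blast
      then show ?thesis
        using homogeneous[of x y u k v] homogeneous[of x z u k v] xyz uv by metis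
    qed
    ultimately show ?thesis using comp_self[of x k] by blast
  qed
  obtain a b where ab: "a \<in> A" "b \<in> V - A" using A by blast
  have "y \<in> A" if "y \<in> comp k a" for y
  proof -
    have "(a, y) \<in> (adj k)\<^sup>*" using that by (simp add: comp_def)
    then show ?thesis by induction (use ab A(3) in \<open>auto simp: adj_def\<close>)
  qed
  then have neq: "comp k a \<noteq> comp k b" using ab comp_self[of b k] by auto
  have aV: "a \<in> V" "b \<in> V" using ab A by auto
  show ?thesis
  proof (cases "\<forall>w\<in>V. comp k w \<in> {comp k a, comp k b}")
    case True
    then show ?thesis using join[of a b b] aV neq by auto
  next
    case False
    then obtain d where d: "d \<in> V" "comp k d \<noteq> comp k a" "comp k d \<noteq> comp k b" by auto
    show ?thesis
    proof (cases "\<forall>w\<in>V. comp k w \<in> {comp k a, comp k b, comp k d}")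
      case True
      have "a \<noteq> b" "a \<noteq> d" "b \<noteq> d" using neq d by auto
      then consider "c a b = c a d" | "c b a = c b d" | "c d a = c d b"
        using no_rainbow[of a b d] aV d sym by metis
      then show ?thesis
      proof cases
        case 1
        then show ?thesis using join[OF aV d(1) neq d(2)[symmetric]] True by blast
      next
        case 2
        moreover have "\<forall>w\<in>V. comp k w \<in> {comp k b, comp k a, comp k d}" using True by blast
        ultimately show ?thesis using join[OF aV(2,1) d(1) neq[symmetric] d(3)[symmetric]] by blast
      next
        case 3
        moreover have "\<forall>w\<in>V. comp k w \<in> {comp k d, comp k a, comp k b}" using True by blast
        ultimately show ?thesis using join[OF d(1) aV d(2,3)] by blast
      qed
    next
      case False
      then obtain e where e: "e \<in> V" "comp k e \<notin> {comp k a, comp k b, comp k d}" by blast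
      have "card {comp k a, comp k b, comp k d, comp k e} = 4" using neq d e by (simp add: eq_commute)
      moreover have "{comp k a, comp k b, comp k d, comp k e} \<subseteq> comp k ` V" using aV d e by auto
      ultimately have "4 \<le> card (comp k ` V)" using card_mono[OF finite_imageI[OF fin]] by metis
      then show ?thesis using k by blast
    qed
  qed
qed

text \<open>Used with \<open>t = 6\<close> for 17 vertices and with \<open>t = 5\<close> for the 16
  left after removing a vertex joined to all others in color \<open>i\<close>. Both counts in the
  proof reach \<open>t + 12\<close> vertices, one too many.\<close>

lemma few_comps:
  assumes V: "card V = t + 11" and t: "t = 5 \<or> t = 6" and i: "i \<in> {1,2,3}"
    and deg: "\<And>x y. x \<in> V \<Longrightarrow> y \<in> V \<Longrightarrow> comp i x \<noteq> comp i y \<Longrightarrow>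
      t \<le> card (nbr i x) + card (nbr i y)"
    and big: "\<And>x y l. x \<in> V \<Longrightarrow> y \<in> V \<Longrightarrow> x \<noteq> y \<Longrightarrow> c x y = i \<Longrightarrow> l \<in> {1,2,3} \<Longrightarrow> l \<noteq> i \<Longrightarrow>
      6 \<le> card (nbr l x \<union> nbr l y)"
  shows "\<not> 4 \<le> card (comp i ` V)"
proof
  assume four: "4 \<le> card (comp i ` V)"
  have "V \<noteq> {}" using V by auto
  then obtain x where x: "x \<in> V" "\<And>y. y \<in> V \<Longrightarrow> card (nbr i x) \<le> card (nbr i y)"
    using ex_is_arg_min_if_finite[OF fin, of "\<lambda>x. card (nbr i x)"]
    by (auto simp: is_arg_min_linorder)
  \<comment> \<open>By \<open>deg\<close>, the components other than that of a vertex of small degree are large; so \<open>x\<close> has minimal degree.\<close>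
  have "\<exists>y\<in>V. comp i y \<noteq> comp i x \<and> card (comp i y) \<le> 4"
  proof (rule ccontr)
    assume neg: "\<not> ?thesis"
    obtain y z w where o: "y \<in> V" "z \<in> V" "w \<in> V"
      "comp i y \<noteq> comp i x" "comp i z \<noteq> comp i x" "comp i w \<noteq> comp i x"
      "comp i y \<noteq> comp i z" "comp i y \<noteq> comp i w" "comp i z \<noteq> comp i w"
      using three_comps[OF x(1) four] by blast
    have large: "5 \<le> card (comp i v) \<and> t < card (comp i v) + card (nbr i x)"
      if "v \<in> V" "comp i v \<noteq> comp i x" for v
      using neg that deg[OF that(1) x(1)] card_nbr_less_comp[OF that(1), of i] by force
    \<comment> \<open>Two of the other components have at least 5 vertices each. If \<open>d\<close>
      is the degree of \<open>x\<close> in color \<open>i\<close>, the third has at least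
      \<open>t + 1 - d\<close> and that of \<open>x\<close> at least \<open>d + 1\<close>:
      \<open>t + 12\<close> in all.\<close>
    show False
      using four_comps_card[OF x(1) o] large[OF o(1,4)] large[OF o(2,5)] large[OF o(3,6)]
        card_nbr_less_comp[OF x(1), of i] V t by linarith
  qed
  then obtain y where y: "y \<in> V" "comp i y \<noteq> comp i x" "card (comp i y) \<le> 4" by blast
  \<comment> \<open>By \<open>deg\<close> and the minimality of \<open>x\<close>, the degree of
    \<open>v\<close> in color \<open>i\<close> is at least half of \<open>t\<close>, hence at least
    3; with at most 4 vertices the component is complete in color \<open>i\<close>.\<close>
  have clique: "nbr i v = comp i y - {v} \<and> card (comp i y) = 4" if v: "v \<in> comp i y" for v
  proof -
    have vV: "v \<in> V" using v comp_subset y by blast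
    have e: "comp i v = comp i y" by (rule comp_eq[OF v])
    have "3 \<le> card (nbr i v)" using deg[of v x] x vV e y t by force
    then have 4: "card (comp i y) = 4" "card (nbr i v) = 3"
      using card_nbr_less_comp[OF vV, of i] e y(3) by auto
    then have "nbr i v = comp i v - {v}"
      using nbr_subset_comp[OF vV, of i] finite_comp[OF vV, of i] e v
      by (intro card_subset_eq) (auto simp: card_Diff_singleton)
    then show ?thesis using e 4 by simp
  qed
  have "card (nbr i y) = 3" using clique[of y] finite_comp[OF y(1), of i] by (simp add: card_Diff_singleton)
  then obtain y' where y': "y' \<in> nbr i y" by fastforce
  then have y'V: "y' \<in> V" "y' \<noteq> y" "c y y' = i" "y' \<in> comp i y" using clique[of y] by (auto simp: nbr_def)
  have ext: "nbr l v \<inter> comp i y = {}" if "l \<noteq> i" "v \<in> comp i y" for l v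
    using clique[OF that(2)] that(1) unfolding nbr_def by blast
  \<comment> \<open>By homogeneity every neighbor of \<open>y'\<close> in color \<open>l\<close> is
    one of \<open>y\<close>, so the union in \<open>big\<close> is just
    \<open>nbr l y\<close>.\<close>
  have deg6: "6 \<le> card (nbr l y)" if l: "l \<in> {1,2,3}" "l \<noteq> i" for l
  proof -
    have "nbr l y' \<subseteq> nbr l y"
    proof
      fix z assume z: "z \<in> nbr l y'"
      then have zV: "z \<in> V" "c y' z = l" "z \<notin> comp i y"
        using ext[OF l(2) y'V(4)] by (auto simp: nbr_def)
      then have "comp i y \<noteq> comp i z" using comp_self[of z i] by blast
      then have "c y' z = c y z" using homogeneous[of y z y' i z] y(1) zV y'V by simp
      then show "z \<in> nbr l y" using zV comp_self[of y i] by (auto simp: nbr_def)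
    qed
    then show ?thesis using big[OF y(1) y'V(1) y'V(2)[symmetric] y'V(3) l] by (simp add: Un_absorb2)
  qed
  obtain p q r where o: "p \<in> V" "q \<in> V" "r \<in> V"
      "comp i p \<noteq> comp i y" "comp i q \<noteq> comp i y" "comp i r \<noteq> comp i y"
      "comp i p \<noteq> comp i q" "comp i p \<noteq> comp i r" "comp i q \<noteq> comp i r"
    using three_comps[OF y(1) four] by blast
  obtain j k where jk: "j \<in> {1,2,3}" "k \<in> {1,2,3}" "j \<noteq> i" "k \<noteq> i" "j \<noteq> k" "{1,2,3} = {i,j,k}"
    by (rule other_colors[OF i]) blast
  have other: "c y v \<in> {j, k}" if "v \<in> V" "comp i v \<noteq> comp i y" for v
  proof -
    have "y \<noteq> v" using that(2) by blast
    then have "c y v \<in> {i, j, k}" "c y v \<noteq> i"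
      using col[OF y(1) that(1)] comp_edge[OF y(1) that(1), of i] that(2) jk(6) by blast+
    then show ?thesis by simp
  qed
  \<comment> \<open>Two other components joined to \<open>y\<close> in the same color
    \<open>l\<close> put \<open>t + 2\<close> vertices into \<open>nbr l y\<close>. With 6 or more
    in \<open>nbr l' y\<close> and the 4 of \<open>comp i y\<close> this gives
    \<open>t + 12\<close>.\<close>
  have pair: False
    if "u \<in> V" "v \<in> V" "comp i u \<noteq> comp i y" "comp i v \<noteq> comp i y" "comp i u \<noteq> comp i v"
      "c y u = c y v" for u v
  proof -
    note uv = that
    define l where "l = c y u"
    define l' where "l' = (if l = j then k else j)"
    have l: "c y u = l" "l' \<in> {1,2,3}" "l' \<noteq> i" "l \<noteq> i" "l \<noteq> l'"
      using other[OF uv(1,3)] jk(1-5) by (auto simp: l_def l'_def)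
    have sub: "comp i w \<subseteq> nbr l y" if w: "w \<in> V" "comp i w \<noteq> comp i y" "c y w = l" for w
    proof
      fix z assume z: "z \<in> comp i w"
      then have "c y z = l" using homogeneous[of y w y i z] w y(1) by auto
      moreover have "z \<noteq> y" using comp_eq[OF z] w(2) by auto
      ultimately show "z \<in> nbr l y" using comp_subset w(1) z by (auto simp: nbr_def)
    qed
    have "card (comp i u \<union> comp i v) \<le> card (nbr l y)"
      using sub[of u] sub[of v] uv l by (intro card_mono) auto
    moreover have "card (comp i u \<union> comp i v) = card (comp i u) + card (comp i v)"
      using uv finite_comp comp_disjoint by (intro card_Un_disjoint) auto
    moreover have "t + 2 \<le> card (comp i u) + card (comp i v)"
      using deg[OF uv(1,2,5)] card_nbr_less_comp[OF uv(1), of i]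
        card_nbr_less_comp[OF uv(2), of i] by linarith
    moreover have "card (nbr l y \<union> nbr l' y \<union> comp i y) \<le> card V"
      using comp_subset[OF y(1), of i] fin by (intro card_mono) (auto simp: nbr_def)
    moreover have "card (nbr l y \<union> nbr l' y \<union> comp i y) = card (nbr l y) + card (nbr l' y) + card (comp i y)"
    proof -
      have "nbr l y \<inter> nbr l' y = {}" using l(5) by (auto simp: nbr_def)
      then show ?thesis
        using ext[of l y] ext[of l' y] l finite_comp[OF y(1)]
        by (subst card_Un_disjoint, simp, simp, simp add: Int_Un_distrib2)
          (simp add: card_Un_disjoint)
    qed
    ultimately show False using deg6[OF l(2,3)] clique[of y] V comp_self[of y i] by linarith
  qed
  \<comment> \<open>Pigeonhole: three components, but only the colors \<open>j\<close> and
    \<open>k\<close> from \<open>y\<close> to them.\<close>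
  have "c y p = c y q \<or> c y p = c y r \<or> c y q = c y r"
    using other[OF o(1,4)] other[OF o(2,5)] other[OF o(3,6)] by auto
  then show False
    using pair[OF o(1,2,4,5,7)] pair[OF o(1,3,4,6,8)] pair[OF o(2,3,5,6,9)] by blast
qed

end


section \<open>Gallai 3-colorings of $K_{17}$\<close>

text \<open>If at most 9 of the 15 vertices off the spine \<open>x y\<close> are pages avoiding
  color \<open>k\<close>, then at least 6 are joined to \<open>x\<close> or \<open>y\<close> in
  color \<open>k\<close>.\<close>

locale book_free = gallai +
  assumes card_V: "card V = 17"
    and union: "k \<in> {1,2,3} \<Longrightarrow> x \<in> V \<Longrightarrow> y \<in> V \<Longrightarrow> x \<noteq> y \<Longrightarrow> c x y \<noteq> k \<Longrightarrow>
      6 \<le> card (nbr k x \<union> nbr k y)"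
begin

text \<open>As \<open>a\<close> sends only color \<open>i\<close>, every other vertex has at least 6
  neighbors in each of the other two colors, so at most 3 of its 15 neighbors in \<open>B\<close>
  have color \<open>i\<close>. Both cases of \<open>join_or_many_comps\<close> then fail on
  \<open>B\<close>.\<close>

lemma no_monochromatic_star:
  assumes a: "a \<in> V" and i: "\<And>y. y \<in> V - {a} \<Longrightarrow> c a y = i"
  shows False
proof -
  define B where "B = V - {a}"
  have "gallai B c" by (rule gallai_subset) (auto simp: B_def)
  interpret B: gallai B c by fact
  have cB: "card B = 16" using a card_V by (simp add: B_def)
  then obtain b where "b \<in> B" by fastforce
  then have i123: "i \<in> {1,2,3}" using i[of b] col[OF a, of b] by (auto simp: B_def)
  have deg6: "6 \<le> card (B.nbr l y)" if l: "l \<in> {1,2,3}" "l \<noteq> i" and y: "y \<in> B" for l y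
  proof -
    have "nbr l a = {}" using i l(2) by (auto simp: nbr_def)
    moreover have "nbr l y = B.nbr l y"
      using i[of y] sym[of y a] l(2) y unfolding nbr_def B.nbr_def by (auto simp: B_def)
    ultimately show ?thesis using union[OF l(1) a, of y] i[of y] l(2) y by (auto simp: B_def)
  qed
  have disj: "B.nbr l y \<inter> B.nbr l' y = {}" if "l \<noteq> l'" for l l' y
    using that by (auto simp: B.nbr_def)
  have upper: "card (B.nbr i y) \<le> 3" if y: "y \<in> B" for y
  proof -
    obtain j k where jk: "j \<in> {1,2,3}" "k \<in> {1,2,3}" "j \<noteq> i" "k \<noteq> i" "j \<noteq> k"
      by (rule other_colors[OF i123]) blast
    have "card (B.nbr i y \<union> (B.nbr j y \<union> B.nbr k y)) =
        card (B.nbr i y) + (card (B.nbr j y) + card (B.nbr k y))"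
      using disj jk by (simp add: card_Un_disjoint Int_Un_distrib)
    moreover have "card (B.nbr i y \<union> (B.nbr j y \<union> B.nbr k y)) \<le> card (B - {y})"
      using B.fin by (intro card_mono) (auto simp: B.nbr_def)
    ultimately show ?thesis using deg6[OF jk(1,3) y] deg6[OF jk(2,4) y] cB y by simp
  qed
  \<comment> \<open>The vertex \<open>a\<close> is a common neighbor in color \<open>i\<close>, so
    at least 5 of the 6 lie in \<open>B\<close>.\<close>
  have pair: "5 \<le> card (B.nbr i y) + card (B.nbr i z)"
    if "y \<in> B" "z \<in> B" "y \<noteq> z" "c y z \<noteq> i" for y z
  proof -
    have "nbr i y \<union> nbr i z = insert a (B.nbr i y \<union> B.nbr i z)"
      using i[of y] sym[of y a] a that(1) unfolding nbr_def B.nbr_def by (auto simp: B_def)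
    then have "6 \<le> card (insert a (B.nbr i y \<union> B.nbr i z))"
      using union[OF i123, of y z] that by (auto simp: B_def)
    also have "\<dots> \<le> Suc (card (B.nbr i y \<union> B.nbr i z))" by (rule card_insert_le_m1) simp_all
    finally show ?thesis using card_Un_le[of "B.nbr i y" "B.nbr i z"] by linarith
  qed
  have lower: "2 \<le> card (B.nbr i y)" if y: "y \<in> B" for y
  proof -
    obtain j where "j \<in> {1,2,3}" "j \<noteq> i" by (rule other_colors[OF i123]) blast
    then have "B.nbr j y \<noteq> {}" "j \<noteq> i" using deg6[of j y] y by auto
    then obtain z where "z \<in> B" "z \<noteq> y" "c y z \<noteq> i" by (auto simp: B.nbr_def)
    then show ?thesis using pair[of y z] upper[of z] y by force
  qed
  \<comment> \<open>If \<open>l = i\<close>, then \<open>y\<close> has at least 8 neighbors in color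
    \<open>i\<close>. Otherwise its neighbors in \<open>i\<close> and in the third color
    \<open>k\<close>, at least 2 + 6, lie among the at most 7 vertices of
    \<open>P - {y}\<close>.\<close>
  have join: False if P: "P \<noteq> {}" "P \<subset> B" "card P \<le> 8" "\<forall>x\<in>P. \<forall>y\<in>B-P. c x y = l" for P l
  proof -
    obtain y where y: "y \<in> P" "y \<in> B" using P(1,2) by blast
    have fP: "finite P" using P(2) B.fin finite_subset by blast
    show False
    proof (cases "l = i")
      case True
      have "card (B - P) \<le> card (B.nbr i y)"
        using P(4) y True by (intro card_mono B.finite_nbr) (auto simp: B.nbr_def)
      then show False using upper[OF y(2)] P(2,3) cB fP by (simp add: card_Diff_subset psubset_imp_subset)
    next
      case False
      obtain j' k' where jk: "j' \<in> {1,2,3}" "k' \<in> {1,2,3}" "j' \<noteq> i" "k' \<noteq> i" "j' \<noteq> k'"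
        by (rule other_colors[OF i123]) blast
      define k where "k = (if l = j' then k' else j')"
      have k: "k \<in> {1,2,3}" "k \<noteq> i" "k \<noteq> l" using jk by (auto simp: k_def)
      have "c y x = l" if "x \<in> B" "x \<notin> P" for x using P(4) y(1) that by blast
      then have "B.nbr k y \<union> B.nbr i y \<subseteq> P - {y}" using k(3) False by (auto simp: B.nbr_def)
      then have "card (B.nbr k y \<union> B.nbr i y) \<le> card (P - {y})" using fP by (intro card_mono) simp_all
      moreover have "card (B.nbr k y \<union> B.nbr i y) = card (B.nbr k y) + card (B.nbr i y)"
        using disj k by (simp add: card_Un_disjoint)
      ultimately show False using deg6[OF k(1,2) y(2)] lower[OF y(2)] P(3) y(1) fP by simp
    qed
  qed
  consider P l where "P \<noteq> {}" "P \<subset> B" "\<forall>x\<in>P. \<forall>y\<in>B-P. c x y = l"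
    | l where "l \<in> {1,2,3}" "4 \<le> card (B.comp l ` B)"
    using B.join_or_many_comps cB by auto
  then show False
  proof cases
    case 1
    have fP: "finite P" using 1(2) B.fin finite_subset by blast
    have "card P \<le> 8 \<or> card (B - P) \<le> 8"
      using 1(2) cB fP by (simp add: card_Diff_subset psubset_imp_subset) linarith
    moreover have "\<forall>x\<in>B-P. \<forall>y\<in>B-(B-P). c x y = l" using 1(3) sym by (metis DiffD1 DiffD2 DiffI)
    ultimately show False using join[of P l] join[of "B - P" l] 1 by blast
  next
    case (2 l)
    show False
    proof (cases "l = i")
      case True
      have "\<not> 4 \<le> card (B.comp i ` B)"
      proof (rule B.few_comps[of 5])
        show "5 \<le> card (B.nbr i x) + card (B.nbr i y)"
          if "x \<in> B" "y \<in> B" "B.comp i x \<noteq> B.comp i y" for x y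
          using pair[OF that(1,2)] that B.comp_edge[OF that(1,2), of i] by auto
        show "6 \<le> card (B.nbr l x \<union> B.nbr l y)" if "x \<in> B" "l \<in> {1,2,3}" "l \<noteq> i" for x y l
          using deg6[OF that(2,3,1)] card_mono[of "B.nbr l x \<union> B.nbr l y" "B.nbr l x"] by simp
      qed (use cB i123 in auto)
      then show False using 2 True by simp
    next
      case False
      \<comment> \<open>Four components of this size exceed 16 vertices.\<close>
      have large: "7 \<le> card (B.comp l y)" if "y \<in> B" for y
        using deg6[OF 2(1) False that] B.card_nbr_less_comp[OF that, of l] by simp
      obtain y z w where o: "y \<in> B" "z \<in> B" "w \<in> B"
        "B.comp l y \<noteq> B.comp l b" "B.comp l z \<noteq> B.comp l b" "B.comp l w \<noteq> B.comp l b"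
        "B.comp l y \<noteq> B.comp l z" "B.comp l y \<noteq> B.comp l w" "B.comp l z \<noteq> B.comp l w"
        using B.three_comps[OF \<open>b \<in> B\<close> 2(2)] by blast
      show False
        using B.four_comps_card[OF \<open>b \<in> B\<close> o] large[OF \<open>b \<in> B\<close>] large[OF o(1)] large[OF o(2)] large[OF o(3)] cB
        by linarith
    qed
  qed
qed

text \<open>Unless \<open>A\<close> is a single vertex, the neighbors of \<open>x\<close>,
  \<open>y\<close> in a color other than \<open>i\<close> and \<open>c x y\<close> lie in
  \<open>A - {x, y}\<close>, which has at most 6 vertices, so they fill it. Then \<open>A\<close>
  has 8 vertices, only two colors inside and no monochromatic triangle, contradicting R(3,3) =
  6.\<close>

lemma no_monochromatic_join:
  assumes A: "A \<noteq> {}" "A \<subset> V" "card A \<le> 8" and i: "\<forall>x\<in>A. \<forall>y\<in>V-A. c x y = i"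
  shows False
proof -
  have fA: "finite A" using A(2) fin finite_subset by blast
  have i123: "i \<in> {1,2,3}"
  proof -
    obtain x y where "x \<in> A" "y \<in> V - A" using A by blast
    then show ?thesis using i col[of x y] A(2) by auto
  qed
  obtain j k where jk: "j \<in> {1,2,3}" "k \<in> {1,2,3}" "j \<noteq> i" "k \<noteq> i" "j \<noteq> k" "{1,2,3} = {i,j,k}"
    by (rule other_colors[OF i123]) blast
  have sub: "nbr l x \<union> nbr l y \<subseteq> A - {x, y}" if "x \<in> A" "y \<in> A" "l \<noteq> i" "c x y \<noteq> l" for l x y
    using that i sym[of x y] by (auto simp: nbr_def)
  have ge6: "6 \<le> card (nbr l x \<union> nbr l y)"
    if "x \<in> A" "y \<in> A" "x \<noteq> y" "l \<in> {1,2,3}" "c x y \<noteq> l" for l x y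
    using that union A(2) by auto
  have cardA2: "card (A - {x, y}) = card A - 2" if "x \<in> A" "y \<in> A" "x \<noteq> y" for x y
    using that fA by (simp add: card_Diff_subset)
  obtain x where x: "x \<in> A" using A by blast
  show False
  proof (cases "A = {x}")
    case True
    then show False using no_monochromatic_star[of x i] x A i by auto
  next
    case False
    then obtain y where y: "y \<in> A" "y \<noteq> x" using x by blast
    obtain l where l: "l \<in> {1,2,3}" "l \<noteq> i" "c x y \<noteq> l" using jk by metis
    have "6 \<le> card (A - {x, y})"
      using ge6[of x y l] sub[of x y l] x y l card_mono[of "A - {x, y}" "nbr l x \<union> nbr l y"] fA by simp
    then have A8: "card A = 8" using cardA2[of x y] x y A(3) by simp
    \<comment> \<open>In other words, every triangle in \<open>A\<close> contains each color other
      than \<open>i\<close>.\<close>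
    have full: "c u w = l \<or> c v w = l"
      if "u \<in> A" "v \<in> A" "w \<in> A" "u \<noteq> v" "u \<noteq> w" "v \<noteq> w" "l \<in> {1,2,3}" "l \<noteq> i" "c u v \<noteq> l" for u v w l
    proof -
      have "card (nbr l u \<union> nbr l v) \<ge> card (A - {u, v})"
        using ge6[of u v l] cardA2[of u v] A8 that by simp
      then have "nbr l u \<union> nbr l v = A - {u, v}"
        using sub[of u v l] that fA by (intro card_seteq) auto
      then have "w \<in> nbr l u \<union> nbr l v" using that(3,5,6) by blast
      then show ?thesis by (auto simp: nbr_def)
    qed
    \<comment> \<open>Otherwise \<open>u w\<close> and \<open>v w\<close> would carry both other
      colors, making \<open>u v w\<close> rainbow.\<close>
    have no_i: "c u v \<noteq> i" if "u \<in> A" "v \<in> A" "u \<noteq> v" for u v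
    proof
      assume uv: "c u v = i"
      have "card (A - {u, v}) = 6" using cardA2[of u v] that A8 by simp
      then have "A - {u, v} \<noteq> {}" by (metis card.empty zero_neq_numeral)
      then obtain w where w: "w \<in> A" "w \<noteq> u" "w \<noteq> v" by blast
      have "c u w = l \<or> c v w = l" if "l \<in> {1,2,3}" "l \<noteq> i" for l
        using full[of u v w l] w \<open>u \<in> A\<close> \<open>v \<in> A\<close> \<open>u \<noteq> v\<close> that uv by metis
      then have "c u w = j \<or> c v w = j" "c u w = k \<or> c v w = k" using jk by blast+
      moreover have "c u v = c u w \<or> c u v = c v w \<or> c u w = c v w"
        using no_rainbow[of u v w] w that A(2) by blast
      ultimately show False using uv jk(3,4,5) by metis
    qed
    \<comment> \<open>Three neighbors of \<open>x\<close> in color \<open>p\<close> would span only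
      color \<open>q\<close>, a triangle without \<open>p\<close>.\<close>
    have few: "card {y \<in> A - {x}. c x y = p} \<le> 2"
      if pq: "p \<in> {1,2,3}" "q \<in> {1,2,3}" "p \<noteq> i" "q \<noteq> i" "p \<noteq> q" for p q
    proof (rule ccontr)
      assume "\<not> ?thesis"
      then have "3 \<le> card {y \<in> A - {x}. c x y = p}" by simp
      then obtain T where T: "T \<subseteq> {y \<in> A - {x}. c x y = p}" "card T = 3"
        by (meson obtain_subset_with_card_n)
      then obtain u v w where "T = {u, v, w}" "u \<noteq> v" "u \<noteq> w" "v \<noteq> w" by (auto simp: card_3_iff)
      with T have uvw: "u \<in> A" "v \<in> A" "w \<in> A" "u \<noteq> x" "v \<noteq> x" "w \<noteq> x" "c x u = p" "c x v = p" "c x w = p"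
        "u \<noteq> v" "u \<noteq> w" "v \<noteq> w" by auto
      have "c u v = q" "c u w = q" "c v w = q"
        using full[of x u v q] full[of x u w q] full[of x v w q] uvw x pq by auto
      then show False using full[of u v w p] uvw pq by auto
    qed
    have "c x y = j \<or> c x y = k" if "y \<in> A" "y \<noteq> x" for y
      using no_i[of x y] col[of x y] x that A(2) jk(6) by blast
    then have "A - {x} \<subseteq> {y \<in> A - {x}. c x y = j} \<union> {y \<in> A - {x}. c x y = k}" by blast
    then have "card (A - {x}) \<le> card ({y \<in> A - {x}. c x y = j} \<union> {y \<in> A - {x}. c x y = k})"
      using fA by (intro card_mono) simp_all
    also have "\<dots> \<le> card {y \<in> A - {x}. c x y = j} + card {y \<in> A - {x}. c x y = k}"
      by (rule card_Un_le)
    also have "\<dots> \<le> 2 + 2" using few[of j k] few[of k j] jk(1-5) by (intro add_mono) blast+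
    finally have "card (A - {x}) \<le> 4" by simp
    moreover have "card (A - {x}) = 7" using A8 x by simp
    ultimately show False by simp
  qed
qed

lemma inconsistent: False
proof -
  consider A l where "A \<noteq> {}" "A \<subset> V" "\<forall>x\<in>A. \<forall>y\<in>V-A. c x y = l"
    | i where "i \<in> {1,2,3}" "4 \<le> card (comp i ` V)"
    using join_or_many_comps card_V by auto
  then show False
  proof cases
    case 1
    have fA: "finite A" using 1(2) fin finite_subset by blast
    have "card A \<le> 8 \<or> card (V - A) \<le> 8"
      using 1(2) card_V fA by (simp add: card_Diff_subset psubset_imp_subset) linarith
    moreover have "\<forall>x\<in>V-A. \<forall>y\<in>V-(V-A). c x y = l" using 1(3) sym by (metis DiffD1 DiffD2 DiffI)
    ultimately show False using no_monochromatic_join[of A l] no_monochromatic_join[of "V - A" l] 1 by blast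
  next
    case (2 i)
    have "\<not> 4 \<le> card (comp i ` V)"
    proof (rule few_comps[of 6])
      show "6 \<le> card (nbr i x) + card (nbr i y)"
        if "x \<in> V" "y \<in> V" "comp i x \<noteq> comp i y" for x y
        using union[OF 2(1) that(1,2)] that comp_edge[OF that(1,2), of i]
          card_Un_le[of "nbr i x" "nbr i y"] by force
      show "6 \<le> card (nbr l x \<union> nbr l y)"
        if "x \<in> V" "y \<in> V" "x \<noteq> y" "c x y = i" "l \<in> {1,2,3}" "l \<noteq> i" for x y l
        using union[OF that(5,1,2,3)] that by auto
    qed (use card_V 2(1) in auto)
    then show False using 2 by simp
  qed
qed

end

section \<open>Two-colored books\<close>

lemma verts_book: "verts (book n) = {..<2} <+> {..<n}"
  by (simp add: book_def graph_join_def complete_graph_def edgeless_graph_def)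

lemma in_verts_book [simp]:
  "Inl i \<in> verts (book n) \<longleftrightarrow> i < 2" "Inr m \<in> verts (book n) \<longleftrightarrow> m < n"
  by (auto simp: verts_book)

lemma edges_book:
  "edges (book n) = insert {Inl 0, Inl 1} {{Inl i, Inr m} | i m. i < 2 \<and> m < n}"
proof -
  have "{e. e \<subseteq> {..<2::nat} \<and> card e = 2} = {{0, 1}}" by (auto simp: card_2_iff)
  then show ?thesis
    by (auto simp: book_def graph_join_def complete_graph_def edgeless_graph_def all_edges_def)
qed

lemma simple_book: "simple_graph (book n)"
  unfolding simple_graph_def all_edges_def by (auto simp: edges_book verts_book)

text \<open>\<open>H\<close> has only the images of the edges of \<open>G\<close> and need not be
  induced, so \<open>h\<close> also reflects edges: by injectivity, equal images come from equal
  vertex sets.\<close>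

lemma image_subgraph_copy:
  assumes G: "simple_graph G" and h: "inj_on h (verts G)" "h ` verts G \<subseteq> {..<p}"
    and H: "H = \<lparr>verts = h ` verts G, edges = image h ` edges G\<rparr>"
  shows "subgraph H (complete_graph p)" "isomorphic G H"
proof -
  have e: "e \<subseteq> verts G" "card e = 2" if "e \<in> edges G" for e
    using G that by (auto simp: simple_graph_def all_edges_def)
  have he: "h ` e \<in> all_edges (h ` verts G)" if "e \<in> edges G" for e
    using e[OF that] h(1) by (auto simp: all_edges_def card_image inj_on_subset)
  then show "subgraph H (complete_graph p)"
    using h(2) by (auto simp: subgraph_def simple_graph_def H complete_graph_def all_edges_def)
  have bwd: "{u, v} \<in> edges G" if "u \<in> verts G" "v \<in> verts G" "{h u, h v} \<in> image h ` edges G" for u v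
  proof -
    have "h ` {u, v} \<in> image h ` edges G" using that(3) by simp
    then obtain d where d: "d \<in> edges G" "h ` {u, v} = h ` d" by blast
    then have "{u, v} = d" using inj_on_image_eq_iff[OF h(1), of "{u, v}" d] e that by auto
    then show ?thesis using d by simp
  qed
  have "{h u, h v} \<in> image h ` edges G" if "{u, v} \<in> edges G" for u v
    using imageI[OF that, of "image h"] by simp
  then have "\<forall>u\<in>verts G. \<forall>v\<in>verts G. {u, v} \<in> edges G \<longleftrightarrow> {h u, h v} \<in> image h ` edges G"
    using bwd by (metis (no_types))
  then show "isomorphic G H"
    unfolding isomorphic_def H using inj_on_imp_bij_betw[OF h(1)] by (intro exI[of _ h]) simp
qed

text \<open>With three colors available, using at most two means omitting some \<open>k\<close>. The
  copy is recorded by its spine and its set of pages.\<close>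

lemma has_book_iff:
  assumes "coloring 3 p f"
  shows "has_copy_with_colors 2 p f (book n) \<longleftrightarrow>
    (\<exists>k\<in>{1,2,3}. \<exists>x<p. \<exists>y<p. \<exists>S\<subseteq>{..<p} - {x, y}. x \<noteq> y \<and> card S = n \<and> f {x, y} \<noteq> k \<and>
      (\<forall>z\<in>S. f {x, z} \<noteq> k \<and> f {y, z} \<noteq> k))" (is "?L \<longleftrightarrow> ?R")
proof
  assume ?L
  then obtain H h where sub: "subgraph H (complete_graph p)" and c2: "card (f ` edges H) \<le> 2"
    and h: "bij_betw h (verts (book n)) (verts H)"
    "\<And>u v. u \<in> verts (book n) \<Longrightarrow> v \<in> verts (book n) \<Longrightarrow> {u, v} \<in> edges (book n) \<longleftrightarrow> {h u, h v} \<in> edges H"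
    unfolding has_copy_with_colors_def isomorphic_def by blast
  have "f ` edges H \<subseteq> {1..3}"
    using sub assms unfolding subgraph_def coloring_def by blast
  then have "finite (f ` edges H)" using finite_subset by blast
  then have "\<not> {1,2,3} \<subseteq> f ` edges H" using c2 card_mono[of "f ` edges H" "{1,2,3}"] by auto
  then obtain k where k: "k \<in> {1,2,3}" "k \<notin> f ` edges H" by blast
  define x where "x = h (Inl 0)"
  define y where "y = h (Inl 1)"
  define S where "S = h ` Inr ` {..<n}"
  have inj: "inj_on h (verts (book n))" and img: "h ` verts (book n) = verts H"
    using h(1) by (auto simp: bij_betw_def)
  have "verts H \<subseteq> {..<p}" using sub by (auto simp: subgraph_def complete_graph_def)
  moreover have "{x, y} \<union> S \<subseteq> verts H"
    unfolding img[symmetric] by (auto simp: x_def y_def S_def verts_book)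
  ultimately have p: "x < p" "y < p" "S \<subseteq> {..<p}" by auto
  have xy: "x \<noteq> y" "x \<notin> S" "y \<notin> S"
    using inj by (auto simp: x_def y_def S_def verts_book dest: inj_onD)
  have "card S = n"
    unfolding S_def image_image using inj
    by (subst card_image) (auto simp: verts_book inj_on_def)
  moreover have "{x, y} \<in> edges H"
    using h(2)[of "Inl 0" "Inl 1"] by (simp add: x_def y_def edges_book)
  moreover have "{x, z} \<in> edges H \<and> {y, z} \<in> edges H" if "z \<in> S" for z
  proof -
    obtain m where m: "m < n" "z = h (Inr m)" using \<open>z \<in> S\<close> by (auto simp: S_def)
    have "{Inl i, Inr m} \<in> edges (book n)" if "i < 2" for i using m(1) that by (auto simp: edges_book)
    then show ?thesis
      using h(2)[of "Inl 0" "Inr m"] h(2)[of "Inl 1" "Inr m"] m by (simp add: x_def y_def)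
  qed
  moreover have "f e \<noteq> k" if "e \<in> edges H" for e using k(2) that by blast
  moreover have "S \<subseteq> {..<p} - {x, y}" using p(3) xy by blast
  ultimately have "\<exists>S\<subseteq>{..<p} - {x, y}. x \<noteq> y \<and> card S = n \<and> f {x, y} \<noteq> k \<and>
      (\<forall>z\<in>S. f {x, z} \<noteq> k \<and> f {y, z} \<noteq> k)"
    using xy(1) by (intro exI[of _ S] conjI ballI) simp_all
  then show ?R using k(1) p(1,2) by blast
next
  assume ?R
  then obtain k x y S where k: "k \<in> {1,2,3}" and xy: "x < p" "y < p" "x \<noteq> y"
    and S: "S \<subseteq> {..<p} - {x, y}" "card S = n"
    and f: "f {x, y} \<noteq> k" "\<And>z. z \<in> S \<Longrightarrow> f {x, z} \<noteq> k \<and> f {y, z} \<noteq> k" by blast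
  have "finite S" using S(1) finite_subset by blast
  then obtain g where g: "bij_betw g {..<n} S"
    using S(2) ex_bij_betw_nat_finite[of S] by (auto simp: lessThan_atLeast0)
  define h where "h = case_sum (\<lambda>i::nat. if i = 0 then x else y) g"
  define H where "H = \<lparr>verts = h ` verts (book n), edges = image h ` edges (book n)\<rparr>"
  have gS: "g m \<in> S" if "m < n" for m using g that by (auto simp: bij_betw_def)
  have inj: "inj_on h (verts (book n))"
  proof (rule inj_onI)
    have ne: "g m \<noteq> x" "g m \<noteq> y" "x \<noteq> g m" "y \<noteq> g m" if "m < n" for m
      using gS[OF that] S(1) by auto
    have "g m = g m' \<Longrightarrow> m = m'" if "m < n" "m' < n" for m m'
      using g that by (auto simp: bij_betw_def dest: inj_onD)
    then show "u = v" if "u \<in> verts (book n)" "v \<in> verts (book n)" "h u = h v" for u v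
      using that ne xy(3) by (cases u; cases v) (auto simp: h_def less_2_cases_iff split: if_splits)
  qed
  have img: "h ` verts (book n) \<subseteq> {..<p}"
  proof -
    have "g m < p" if "m < n" for m using gS[OF that] S(1) by auto
    then show ?thesis using xy unfolding verts_book h_def by auto
  qed
  note copy = image_subgraph_copy[OF simple_book inj img H_def]
  have "f e \<in> {1,2,3} - {k}" if "e \<in> edges H" for e
  proof -
    have f13: "f e \<in> {1..3}"
      using copy(1) assms that unfolding subgraph_def coloring_def by blast
    have "e \<in> image h ` edges (book n)" using that by (simp add: H_def)
    then obtain d where d: "d \<in> edges (book n)" "e = h ` d" by (rule imageE)
    from d(1) have "f (h ` d) \<noteq> k"
      unfolding edges_book
    proof (elim insertE CollectE exE conjE)
      assume "d = {Inl 0, Inl 1}"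
      then show ?thesis using f(1) by (simp add: h_def)
    next
      fix i m assume "d = {Inl i, Inr m}" "i < 2" "m < n"
      then show ?thesis using f(2)[OF gS[of m]] by (simp add: h_def)
    qed
    then show ?thesis using d(2) f13 by auto
  qed
  then have "f ` edges H \<subseteq> {1,2,3} - {k}" by blast
  then have "card (f ` edges H) \<le> card ({1,2,3} - {k})" by (intro card_mono) auto
  then have "card (f ` edges H) \<le> 2" using k by auto
  then show ?L unfolding has_copy_with_colors_def using copy by blast
qed

section \<open>The book in Gallai 3-colorings of K_17\<close>

lemma gallai_17_has_book:
  assumes "gallai_coloring 3 17 f"
  shows "has_copy_with_colors 2 17 f (book 10)"
proof (rule ccontr)
  assume neg: "\<not> ?thesis"
  have colf: "coloring 3 17 f" using assms by (simp add: gallai_coloring_def)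
  have f: "f {x, y} \<in> {1,2,3}" if "x < 17" "y < 17" "x \<noteq> y" for x y
  proof -
    have "f {x, y} \<in> {1..3}"
      using colf that by (auto simp: coloring_def complete_graph_def all_edges_def)
    then show ?thesis by auto
  qed
  have "gallai {..<17} (\<lambda>x y. f {x, y})"
  proof
    show "f {x, y} \<in> {1,2,3}" if "x \<in> {..<17}" "y \<in> {..<17}" "x \<noteq> y" for x y
      using f that by simp
    show "f {x, y} = f {x, z} \<or> f {x, y} = f {y, z} \<or> f {x, z} = f {y, z}"
      if "x \<in> {..<17}" "y \<in> {..<17}" "z \<in> {..<17}" "x \<noteq> y" "x \<noteq> z" "y \<noteq> z" for x y z
      using assms that unfolding gallai_coloring_def rainbow_triangle_def complete_graph_def by auto
  qed (simp_all add: insert_commute)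
  then interpret gallai "{..<17}" "\<lambda>x y. f {x, y}" .
  have "book_free {..<17} (\<lambda>x y. f {x, y})"
  proof
    fix k x y assume k: "k \<in> {1,2,3}" and xy: "x \<in> {..<17}" "y \<in> {..<17}" "x \<noteq> y" "f {x, y} \<noteq> k"
    show "6 \<le> card (nbr k x \<union> nbr k y)"
    proof (rule ccontr)
      assume small: "\<not> ?thesis"
      \<comment> \<open>Excluding at most 5 vertices leaves at least 17 - 2 - 5 = 10 pages.\<close>
      have "17 - card ({x, y} \<union> (nbr k x \<union> nbr k y)) \<le> card ({..<17} - ({x, y} \<union> (nbr k x \<union> nbr k y)))"
        using diff_card_le_card_Diff[of "{x, y} \<union> (nbr k x \<union> nbr k y)" "{..<17}"] by simp
      moreover have "card ({x, y} \<union> (nbr k x \<union> nbr k y)) \<le> 2 + card (nbr k x \<union> nbr k y)"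
        using card_Un_le[of "{x, y}" "nbr k x \<union> nbr k y"] xy(3) by simp
      ultimately have "10 \<le> card ({..<17} - ({x, y} \<union> (nbr k x \<union> nbr k y)))" using small by linarith
      then obtain S where S: "S \<subseteq> {..<17} - ({x, y} \<union> (nbr k x \<union> nbr k y))" "card S = 10"
        by (meson obtain_subset_with_card_n)
      have "f {x, z} \<noteq> k \<and> f {y, z} \<noteq> k" if "z \<in> S" for z
        using S(1) that by (auto simp: nbr_def)
      moreover have "S \<subseteq> {..<17} - {x, y}" using S(1) by blast
      ultimately show False using neg has_book_iff[OF colf, of 10] k xy S(2) by (metis lessThan_iff)
    qed
  qed simp
  then show False by (rule book_free.inconsistent)
qed

section \<open>A coloring of $K_{16}$\<close>

text \<open>Colors 2 and 3 are the two 5-cycles that make up K_5; the diagonal value 1 becomes the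
  color inside a blown-up class.\<close>

definition pentagon_color :: "nat \<Rightarrow> nat \<Rightarrow> nat" where
  "pentagon_color r s = (if r = s then 1 else if (r + 1) mod 5 = s \<or> (s + 1) mod 5 = r then 2 else 3)"

definition blowup_color :: "nat \<Rightarrow> nat \<Rightarrow> nat" where
  "blowup_color u v = (if u = 15 \<or> v = 15 then 1 else pentagon_color (u mod 5) (v mod 5))"

lemma blowup_color_sym: "blowup_color u v = blowup_color v u"
  unfolding blowup_color_def pentagon_color_def by auto

lemma blowup_color_range: "blowup_color u v \<in> {1,2,3}"
  unfolding blowup_color_def pentagon_color_def by auto

text \<open>Three distinct values of \<open>pentagon_color\<close> would include 1, but then two
  indices coincide and the other two values agree. Vertex 15 sends only color 1.\<close>

lemma blowup_color_no_rainbow: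
  "blowup_color u v = blowup_color u w \<or> blowup_color u v = blowup_color v w \<or>
    blowup_color u w = blowup_color v w"
proof -
  have "pentagon_color r s = pentagon_color r t \<or> pentagon_color r s = pentagon_color s t \<or>
      pentagon_color r t = pentagon_color s t" for r s t
    unfolding pentagon_color_def by (simp split: if_splits)
  then show ?thesis unfolding blowup_color_def by (simp split: if_splits)
qed

lemma card_residues:
  assumes "a < 5" "b < 5" "a \<noteq> (b::nat)"
  shows "card {a, a + 5, a + 10, b, b + 5, b + 10} = 6"
  using assms by (simp add: card_insert_if)

lemma pentagon_color_neighbors:
  assumes "r < 5" "k = 2 \<or> k = 3"
  obtains a b where "a < 5" "b < 5" "a \<noteq> b" "pentagon_color r a = k" "pentagon_color r b = k"
proof -
  \<comment> \<open>These are \<open>r\<close> plus and minus \<open>k - 1\<close> modulo 5: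
    distance 1 on the pentagon for color 2, distance 2 for color 3.\<close>
  have "(r + k - 1) mod 5 \<noteq> (r + 6 - k) mod 5 \<and>
      pentagon_color r ((r + k - 1) mod 5) = k \<and> pentagon_color r ((r + 6 - k) mod 5) = k"
  proof -
    consider "r = 0" | "r = 1" | "r = 2" | "r = 3" | "r = 4" using assms(1) by linarith
    then show ?thesis using assms(2) by cases (elim disjE; simp add: pentagon_color_def)+
  qed
  then show thesis using that[of "(r + k - 1) mod 5" "(r + 6 - k) mod 5"] by simp
qed

text \<open>Two adjacent classes of three vertices each.\<close>

lemma blowup_color_degree:
  assumes "x < 15" "k = 2 \<or> k = 3"
  shows "6 \<le> card {z \<in> {..<16}. z \<noteq> x \<and> blowup_color x z = k}"
proof -
  obtain a b where ab: "a < 5" "b < 5" "a \<noteq> b" "pentagon_color (x mod 5) a = k" "pentagon_color (x mod 5) b = k"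
    using pentagon_color_neighbors[of "x mod 5" k] assms(2) by auto
  have mem: "z \<in> {z \<in> {..<16}. z \<noteq> x \<and> blowup_color x z = k}"
    if "z < 15" "pentagon_color (x mod 5) (z mod 5) = k" for z
    using that assms by (auto simp: blowup_color_def pentagon_color_def)
  have "{a, a + 5, a + 10, b, b + 5, b + 10} \<subseteq> {z \<in> {..<16}. z \<noteq> x \<and> blowup_color x z = k}"
    using ab mod_mult_self1[of a 2 5] mod_mult_self1[of b 2 5]
    by (intro insert_subsetI empty_subsetI mem) simp_all
  from card_mono[OF _ this] show ?thesis using card_residues[OF ab(1-3)] by simp
qed

text \<open>The classes of \<open>x\<close> and \<open>y\<close> differ; each contributes its two
  other vertices, and vertex 15 is the fifth.\<close>

lemma blowup_color_1_neighbors: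
  assumes "x < 15" "y < 15" "blowup_color x y \<noteq> 1"
  shows "5 \<le> card ({z \<in> {..<16}. z \<noteq> x \<and> blowup_color x z = 1} \<union>
      {z \<in> {..<16}. z \<noteq> y \<and> blowup_color y z = 1})"
proof -
  define a where "a = x mod 5"
  define b where "b = y mod 5"
  have ab: "a < 5" "b < 5" "a \<noteq> b" using assms
    by (auto simp: a_def b_def blowup_color_def pentagon_color_def split: if_splits)
  let ?U = "{z \<in> {..<16}. z \<noteq> x \<and> blowup_color x z = 1} \<union>
      {z \<in> {..<16}. z \<noteq> y \<and> blowup_color y z = 1}"
  have mem: "z \<in> ?U \<union> {x, y}" if "z = 15 \<or> z < 15 \<and> (z mod 5 = a \<or> z mod 5 = b)" for z
  proof (cases "z = 15")
    case True
    then show ?thesis using assms by (simp add: blowup_color_def)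
  next
    case False
    then have "z < 15" "z mod 5 = x mod 5 \<or> z mod 5 = y mod 5" using that by (simp_all add: a_def b_def)
    then have "blowup_color x z = 1 \<or> blowup_color y z = 1" by (auto simp: blowup_color_def pentagon_color_def)
    then show ?thesis using \<open>z < 15\<close> by auto
  qed
  have "{15, a, a + 5, a + 10, b, b + 5, b + 10} \<subseteq> ?U \<union> {x, y}"
    using ab mod_mult_self1[of a 2 5] mod_mult_self1[of b 2 5]
    by (intro insert_subsetI empty_subsetI mem) simp_all
  then have "card ({15, a, a + 5, a + 10, b, b + 5, b + 10} - {x, y}) \<le> card ?U"
    by (intro card_mono) (simp, blast)
  moreover have "card {15, a, a + 5, a + 10, b, b + 5, b + 10} = 7"
    using ab by (simp add: card_insert_if)
  moreover have "card {x, y} \<le> 2" by (simp add: card_insert_if)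
  moreover have "card {15, a, a + 5, a + 10, b, b + 5, b + 10} - card {x, y} \<le>
      card ({15, a, a + 5, a + 10, b, b + 5, b + 10} - {x, y})"
    by (rule diff_card_le_card_Diff) simp
  ultimately show ?thesis by linarith
qed

text \<open>This leaves at most 16 - 2 - 5 = 9 pages. A spine avoiding color 1 misses vertex 15; for
  the other colors, an endpoint below 15 suffices.\<close>

lemma blowup_color_neighbors:
  assumes "x < 16" "y < 16" "x \<noteq> y" "k \<in> {1,2,3}" "blowup_color x y \<noteq> k"
  shows "5 \<le> card ({z \<in> {..<16}. z \<noteq> x \<and> blowup_color x z = k} \<union>
      {z \<in> {..<16}. z \<noteq> y \<and> blowup_color y z = k})"
    (is "5 \<le> card (?N x \<union> ?N y)")
proof (cases "k = 1")
  case True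
  have "x \<noteq> 15" "y \<noteq> 15" using assms(5) True by (auto simp: blowup_color_def)
  then show ?thesis using blowup_color_1_neighbors[of x y] assms True by simp
next
  case False
  then have k: "k = 2 \<or> k = 3" using assms(4) by simp
  have "x < 15 \<or> y < 15" using assms by linarith
  moreover have "card (?N x) \<le> card (?N x \<union> ?N y)" "card (?N y) \<le> card (?N x \<union> ?N y)"
    by (intro card_mono; simp)+
  ultimately show ?thesis using blowup_color_degree[OF _ k, of x] blowup_color_degree[OF _ k, of y] by linarith
qed

text \<open>Leastness needs a counterexample for every \<open>p\<close> up to 16; restrictions of
  one coloring provide them.\<close>

lemma gallai_without_book:
  assumes "p \<le> 16"
  shows "\<exists>f. gallai_coloring 3 p f \<and> \<not> has_copy_with_colors 2 p f (book 10)"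
proof -
  \<comment> \<open>\<open>Min\<close> and \<open>Max\<close> recover the endpoints of an edge;
    \<open>blowup_color\<close> is symmetric, so their order does not matter.\<close>
  define f where "f e = blowup_color (Min e) (Max e)" for e
  have f: "f {u, v} = blowup_color u v" for u v
    by (simp add: f_def min_def max_def blowup_color_sym)
  have col: "coloring 3 p f"
    unfolding coloring_def
  proof
    fix e
    show "f e \<in> {1..3}" using blowup_color_range[of "Min e" "Max e"] by (auto simp: f_def)
  qed
  have "gallai_coloring 3 p f"
    unfolding gallai_coloring_def rainbow_triangle_def f using col blowup_color_no_rainbow by metis
  moreover have "\<not> has_copy_with_colors 2 p f (book 10)"
  proof
    assume "has_copy_with_colors 2 p f (book 10)"
    then obtain k x y S where k: "k \<in> {1,2,3}" and xy: "x < p" "y < p" "x \<noteq> y"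
      and S: "S \<subseteq> {..<p} - {x, y}" "card S = 10" and spine: "blowup_color x y \<noteq> k"
      "\<forall>z\<in>S. blowup_color x z \<noteq> k \<and> blowup_color y z \<noteq> k"
      unfolding has_book_iff[OF col] f by blast
    \<comment> \<open>\<open>N\<close> is taken within 16 vertices even for smaller
      \<open>p\<close>. It is disjoint from the 12 vertices of the book, and 5 + 12 exceeds
      16.\<close>
    define N where "N = {z \<in> {..<16}. z \<noteq> x \<and> blowup_color x z = k} \<union>
      {z \<in> {..<16}. z \<noteq> y \<and> blowup_color y z = k}"
    have "5 \<le> card N" unfolding N_def using blowup_color_neighbors[of x y k] k xy spine(1) assms by simp
    moreover have "x \<notin> N" "y \<notin> N" using spine(1) blowup_color_sym[of x y] by (auto simp: N_def)
    then have "N \<inter> (S \<union> {x, y}) = {}" using spine(2) by (auto simp: N_def)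
    moreover have "finite N" "finite S" using S(1) finite_subset by (auto simp: N_def)
    moreover have "card (S \<union> {x, y}) = 12"
      using S xy(3) \<open>finite S\<close> by (subst card_Un_disjoint) auto
    moreover have "card (N \<union> (S \<union> {x, y})) \<le> card {..<16::nat}"
      using S(1) xy assms by (intro card_mono) (auto simp: N_def)
    ultimately show False by (simp add: card_Un_disjoint del: Un_insert_right)
  qed
  ultimately show ?thesis by blast
qed

theorem theorem4p6:
  shows "gallai_ramsey 3 2 (book 10) = 17"
  unfolding gallai_ramsey_def
proof (rule Least_equality)
  show "\<forall>f. gallai_coloring 3 17 f \<longrightarrow> has_copy_with_colors 2 17 f (book 10)"
    using gallai_17_has_book by blast
  show "17 \<le> p" if "\<forall>f. gallai_coloring 3 p f \<longrightarrow> has_copy_with_colors 2 p f (book 10)" for p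
    using gallai_without_book[of p] that by (cases "p \<le> 16") auto
qed

end
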